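(* For every $n\ge 2$, the tropicalization of the Pollaczek-Geiringer variety $\mathrm{CM}_n^2$ is the Minkowski sum of two copies of the set of ultrametrics on $[n]$: $$\mathrm{trop}(\mathrm{CM}_n^2)=U_n+U_n=\{\delta+\delta' : \delta,\delta'\in U_n\}\subseteq \mathbb{R}^{\binom{[n]}{2}}.$$
   Context: Coordinates of $\mathbb{C}^{\binom{[n]}{2}}$ and $\mathbb{R}^{\binom{[n]}{2}}$ are indexed by unordered pairs $uv$ with $u<v$ in $[n]=\{1,\dots,n\}$. The Cayley-Menger variety $\mathrm{CM}_n^d\subseteq\mathbb{C}^{\binom{[n]}{2}}$ is the Zariski closure of the set of vectors $(\|p_u-p_v\|^2)_{u<v}$ where $p_1,\dots,p_n$ range over $\mathbb{R}^d$; for $d=2$ it is called the Pollaczek-Geiringer variety. Tropicalization uses the max convention: let $K=\mathbb{C}\{\!\{t\}\!\}$ be the field of complex Puiseux series with valuation $\mathrm{val}(a)=-(\text{smallest exponent of } t \text{ occurring in } a)$ and $\mathrm{val}(0)=-\infty$. For a variety $X\subseteq\mathbb{C}^S$ with ideal $I$, let $X'\subseteq K^S$ be the vanishing set of $I\cdot K[x_i:i\in S]$; then $\mathrm{trop}(X)$ is the Euclidean closure of $\{(\mathrm{val}(x_i))_{i\in S}: x\in X'\}\cap\mathbb{R}^S$. A vector $\delta\in\mathbb{R}^{\binom{[n]}{2}}$ is an ultrametric if $\delta_{uv}\le\max\{\delta_{uw},\delta_{vw}\}$ for all triples of distinct $u,v,w\in[n]$ (no nonnegativity is required); $U_n$ denotes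 the set of all ultrametrics in $\mathbb{R}^{\binom{[n]}{2}}$. *)

theory Defs
  imports "HOL-Analysis.Analysis" "HOL-Library.Poly_Mapping"
    "HOL-Computational_Algebra.Formal_Laurent_Series"
begin

definition pairs :: "nat \<Rightarrow> (nat \<times> nat) set" where
  "pairs n = {(u, v). 1 \<le> u \<and> u < v \<and> v \<le> n}"

text \<open>Polynomials with complex coefficients in variables indexed by nat x nat:
  finitely supported maps from monomials (finitely supported exponent vectors) to coefficients.\<close>
type_synonym mpoly = "((nat \<times> nat, nat) poly_mapping, complex) poly_mapping"

definition poly_in :: "(nat \<times> nat) set \<Rightarrow> mpoly \<Rightarrow> bool" where
  "poly_in S p \<longleftrightarrow> (\<forall>mon\<in>Poly_Mapping.keys p. Poly_Mapping.keys mon \<subseteq> S)"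

definition mpeval :: "(complex \<Rightarrow> 'a::comm_ring_1) \<Rightarrow> mpoly \<Rightarrow> (nat \<times> nat \<Rightarrow> 'a) \<Rightarrow> 'a" where
  "mpeval c p x = (\<Sum>m\<in>Poly_Mapping.keys p. c (Poly_Mapping.lookup p m) * (\<Prod>i\<in>Poly_Mapping.keys m. x i ^ Poly_Mapping.lookup m i))"

text \<open>Points of C^S are functions vanishing outside S.\<close>
definition vanishing_ideal :: "(nat \<times> nat) set \<Rightarrow> (nat \<times> nat \<Rightarrow> complex) set \<Rightarrow> mpoly set" where
  "vanishing_ideal S X = {p. poly_in S p \<and> (\<forall>x\<in>X. mpeval id p x = 0)}"

definition zero_set :: "(nat \<times> nat) set \<Rightarrow> mpoly set \<Rightarrow> (nat \<times> nat \<Rightarrow> complex) set" where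
  "zero_set S P = {x. (\<forall>i. i \<notin> S \<longrightarrow> x i = 0) \<and> (\<forall>p\<in>P. mpeval id p x = 0)}"

definition zariski_closure :: "(nat \<times> nat) set \<Rightarrow> (nat \<times> nat \<Rightarrow> complex) set \<Rightarrow> (nat \<times> nat \<Rightarrow> complex) set" where
  "zariski_closure S X = zero_set S (vanishing_ideal S X)"

definition CM :: "nat \<Rightarrow> nat \<Rightarrow> (nat \<times> nat \<Rightarrow> complex) set" where
  "CM n d = zariski_closure (pairs n)
     {x. \<exists>p :: nat \<Rightarrow> nat \<Rightarrow> real.
         x = (\<lambda>(u, v). if (u, v) \<in> pairs n
                        then complex_of_real (\<Sum>i<d. (p u i - p v i)^2) else 0)}"

text \<open>Tropicalization (max convention) over the complex Puiseux series field K.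
  A point of K^S (S finite) has a common denominator N, i.e. its coordinates are
  y_i(t^(1/N)) with y_i in C((s)) (formal Laurent series). Its valuation is
  -(smallest exponent) = -(subdegree y_i)/N. The K-points of V(I K[x]) are those at
  which all p in I vanish; intersecting with R^S means all coordinates nonzero.
  The Euclidean closure is taken in the product topology on nat x nat => real, on
  which vectors vanishing outside the finite set S form a copy of R^S.\<close>
definition trop :: "(nat \<times> nat) set \<Rightarrow> (nat \<times> nat \<Rightarrow> complex) set \<Rightarrow> (nat \<times> nat \<Rightarrow> real) set" where
  "trop S X = closure
     {\<delta>. \<exists>(N::nat) (y :: nat \<times> nat \<Rightarrow> complex fls). N > 0 \<and>
          (\<forall>i\<in>S. y i \<noteq> 0) \<and>
          (\<forall>p\<in>vanishing_ideal S X. mpeval fls_const p y = 0) \<and>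
          \<delta> = (\<lambda>i. if i \<in> S then - real_of_int (fls_subdegree (y i)) / real N else 0)}"

definition dist_pair :: "(nat \<times> nat \<Rightarrow> real) \<Rightarrow> nat \<Rightarrow> nat \<Rightarrow> real" where
  "dist_pair \<delta> u v = \<delta> (min u v, max u v)"

definition ultrametrics :: "nat \<Rightarrow> (nat \<times> nat \<Rightarrow> real) set" where
  "ultrametrics n = {\<delta>. (\<forall>i. i \<notin> pairs n \<longrightarrow> \<delta> i = 0) \<and>
     (\<forall>u\<in>{1..n}. \<forall>v\<in>{1..n}. \<forall>w\<in>{1..n}. u \<noteq> v \<and> u \<noteq> w \<and> v \<noteq> w \<longrightarrow>
        dist_pair \<delta> u v \<le> max (dist_pair \<delta> u w) (dist_pair \<delta> v w))}"

end

theory Submission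
  imports Defs
begin

unbundle fps_syntax
unbundle no vec_syntax

text \<open>Since \<open>x\<^sup>2 + z\<^sup>2 = (x + \<i>z)(x - \<i>z)\<close>, the variety is parametrized by
  \<open>y\<^sub>u\<^sub>v = (a\<^sub>u - a\<^sub>v)(b\<^sub>u - b\<^sub>v)\<close>, and \<open>(u, v) \<mapsto> val (a\<^sub>u - a\<^sub>v)\<close> is an ultrametric.
  The parametrization is surjective over an algebraically closed field, because a symmetric matrix of
  rank at most 2 is the Gram matrix of planar points; a single square root suffices for this, so over
  Laurent series in \<open>s\<close> it is enough to substitute \<open>s\<^sup>2\<close> for \<open>s\<close>. Hence the valuation of
  every point is a sum of two ultrametrics, and the set of such sums is closed.

  Conversely, every integral ultrametric is \<open>val (a\<^sub>u - a\<^sub>v)\<close> for suitable Laurent series, and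
  rounding is monotone, so that rational ultrametrics are dense. A polynomial vanishing on all real
  planar configurations vanishes on all Laurent series configurations: replace the real coordinates
  by Laurent series one at a time.\<close>

section \<open>Evaluation of polynomials\<close>

lemma mpeval_superset:
  assumes "finite T" "Poly_Mapping.keys p \<subseteq> T" "c 0 = 0"
  shows "mpeval c p x =
    (\<Sum>m\<in>T. c (Poly_Mapping.lookup p m) * (\<Prod>i\<in>Poly_Mapping.keys m. x i ^ Poly_Mapping.lookup m i))"
  unfolding mpeval_def
  by (rule sum.mono_neutral_left) (use assms in \<open>auto simp: in_keys_iff\<close>)

lemma monomial_eval_plus:
  fixes x :: "'b \<Rightarrow> 'a::comm_ring_1" and m m' :: "('b, nat) poly_mapping"
  shows "(\<Prod>i\<in>Poly_Mapping.keys (m + m'). x i ^ Poly_Mapping.lookup (m + m') i) =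
    (\<Prod>i\<in>Poly_Mapping.keys m. x i ^ Poly_Mapping.lookup m i) *
    (\<Prod>i\<in>Poly_Mapping.keys m'. x i ^ Poly_Mapping.lookup m' i)"
proof -
  let ?T = "Poly_Mapping.keys m \<union> Poly_Mapping.keys m'"
  have sup: "(\<Prod>i\<in>Poly_Mapping.keys k. x i ^ Poly_Mapping.lookup k i) =
      (\<Prod>i\<in>?T. x i ^ Poly_Mapping.lookup k i)"
    if "Poly_Mapping.keys k \<subseteq> ?T" for k
    by (rule prod.mono_neutral_left) (use that in \<open>auto simp: in_keys_iff\<close>)
  show ?thesis
    unfolding sup[OF keys_add] sup[OF Un_upper1] sup[OF Un_upper2]
    by (simp add: lookup_add power_add prod.distrib)
qed

lemma mpoly_sum_monomials:
  fixes p :: mpoly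
  shows "p = (\<Sum>m\<in>Poly_Mapping.keys p. Poly_Mapping.single m (Poly_Mapping.lookup p m))"
  by (rule poly_mapping_eqI)
    (auto simp: lookup_sum lookup_single when_def in_keys_iff)

text \<open>Two coefficient maps occur: \<open>id\<close> evaluates at complex points and defines
  the ideal of the variety, \<open>fls_const\<close> evaluates the same polynomials at Laurent
  series points.\<close>

locale coeff_hom =
  fixes c :: "complex \<Rightarrow> 'a::comm_ring_1"
  assumes c_add: "c (a + b) = c a + c b"
    and c_mult: "c (a * b) = c a * c b"
    and c_one: "c 1 = 1"
begin

lemma c_zero: "c 0 = 0"
  using c_add[of 0 0] by simp

lemma mpeval_add: "mpeval c (p + q) x = mpeval c p x + mpeval c q x"
proof -
  let ?T = "Poly_Mapping.keys p \<union> Poly_Mapping.keys q"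
  have "finite ?T" by simp
  then show ?thesis
    using keys_add[of p q]
    by (simp add: mpeval_superset[of ?T] c_zero lookup_add c_add sum.distrib algebra_simps)
qed

lemma mpeval_zero: "mpeval c 0 x = 0"
  by (simp add: mpeval_def)

lemma mpeval_uminus: "mpeval c (- p) x = - mpeval c p x"
  using mpeval_add[of p "- p" x] by (simp add: mpeval_zero eq_neg_iff_add_eq_0 add.commute)

lemma mpeval_diff: "mpeval c (p - q) x = mpeval c p x - mpeval c q x"
  using mpeval_add[of p "- q" x] by (simp add: mpeval_uminus)

lemma mpeval_single:
  "mpeval c (Poly_Mapping.single m a) x =
    c a * (\<Prod>i\<in>Poly_Mapping.keys m. x i ^ Poly_Mapping.lookup m i)"
  by (simp add: mpeval_superset[of "{m}"] c_zero)

lemma mpeval_var: "mpeval c (Poly_Mapping.single (Poly_Mapping.single i 1) 1) x = x i"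
  by (simp add: mpeval_single c_one)

lemma mpeval_sum: "mpeval c (\<Sum>k\<in>T. f k) x = (\<Sum>k\<in>T. mpeval c (f k) x)"
  by (induction T rule: infinite_finite_induct) (simp_all add: mpeval_zero mpeval_add)

lemma mpeval_mult: "mpeval c (p * q) x = mpeval c p x * mpeval c q x"
proof -
  let ?s = "\<lambda>p m. Poly_Mapping.single m (Poly_Mapping.lookup p m)"
  have "mpeval c (p * q) x =
      mpeval c ((\<Sum>m\<in>Poly_Mapping.keys p. ?s p m) * (\<Sum>m\<in>Poly_Mapping.keys q. ?s q m)) x"
    by (simp only: mpoly_sum_monomials[symmetric])
  also have "\<dots> = (\<Sum>m\<in>Poly_Mapping.keys p. mpeval c (?s p m) x) * (\<Sum>m\<in>Poly_Mapping.keys q. mpeval c (?s q m) x)"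
    by (simp add: sum_product mpeval_sum mult_single mpeval_single c_mult monomial_eval_plus mult_ac)
  also have "\<dots> = mpeval c p x * mpeval c q x"
    by (simp only: mpeval_sum[symmetric] mpoly_sum_monomials[symmetric])
  finally show ?thesis .
qed

end

interpretation id_hom: coeff_hom "id :: complex \<Rightarrow> complex"
  by unfold_locales auto

interpretation fls_hom: coeff_hom fls_const
  by unfold_locales (auto simp: fls_plus_const)

section \<open>Polynomials in a restricted set of variables\<close>

lemma poly_in_add: "poly_in S p \<Longrightarrow> poly_in S q \<Longrightarrow> poly_in S (p + q)"
  unfolding poly_in_def using keys_add[of p q] by blast

lemma poly_in_diff: "poly_in S p \<Longrightarrow> poly_in S q \<Longrightarrow> poly_in S (p - q)"
  unfolding poly_in_def using keys_add[of p "- q"] by force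

lemma poly_in_mult: "poly_in S p \<Longrightarrow> poly_in S q \<Longrightarrow> poly_in S (p * q)"
proof -
  assume *: "poly_in S p" "poly_in S q"
  show ?thesis
    unfolding poly_in_def
  proof
    fix m assume "m \<in> Poly_Mapping.keys (p * q)"
    then obtain a b where "m = a + b" "a \<in> Poly_Mapping.keys p" "b \<in> Poly_Mapping.keys q"
      using keys_mult[of p q] by blast
    then show "Poly_Mapping.keys m \<subseteq> S"
      using * keys_add[of a b] unfolding poly_in_def by blast
  qed
qed

lemma poly_in_zero: "poly_in S 0"
  by (simp add: poly_in_def)

lemma poly_in_var: "i \<in> S \<Longrightarrow> poly_in S (Poly_Mapping.single (Poly_Mapping.single i 1) 1)"
  by (simp add: poly_in_def)

text \<open>Ring homomorphisms commute with finite sums and products. The two uses are the embedding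
  \<open>fls_const\<close> of the complex numbers and the evaluation of univariate polynomials at a
  point.\<close>

lemma mpeval_hom:
  assumes h0: "h 0 = 0" and h1: "h 1 = 1" and ha: "\<And>a b. h (a + b) = h a + h b"
    and hm: "\<And>a b. h (a * b) = h a * h b"
  shows "h (mpeval c p x) = mpeval (\<lambda>a. h (c a)) p (\<lambda>i. h (x i))"
proof -
  have sum: "h (sum f T) = (\<Sum>k\<in>T. h (f k))" for f T
    by (induction T rule: infinite_finite_induct) (simp_all add: h0 ha)
  have pow: "h (a ^ k) = h a ^ k" for a and k :: nat
    by (induction k) (simp_all add: h1 hm)
  have prod: "h (prod f T) = (\<Prod>k\<in>T. h (f k))" for f T
    by (induction T rule: infinite_finite_induct) (simp_all add: h1 hm)
  show ?thesis
    by (simp add: mpeval_def sum prod pow hm)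
qed

lemma mpeval_cong:
  assumes "poly_in S p" "\<And>i. i \<in> S \<Longrightarrow> x i = y i"
  shows "mpeval c p x = mpeval c p y"
  unfolding mpeval_def
  by (intro sum.cong prod.cong arg_cong2[where f = "(*)"] refl)
    (metis assms poly_in_def subset_iff)

section \<open>Factorization of planar squared distances\<close>

text \<open>\<open>gram D\<close> is twice the Gram matrix of a configuration with squared distances \<open>D\<close> and base
  point 1. Up to sign, \<open>rank_relation D u v w\<close> is \<open>gram D 2 2\<close> times its 3x3 minor with rows
  2, u, w and columns 2, v, w.\<close>

definition gram :: "(nat \<Rightarrow> nat \<Rightarrow> 'a::comm_ring_1) \<Rightarrow> nat \<Rightarrow> nat \<Rightarrow> 'a" where
  "gram D u v = D 1 u + D 1 v - D u v"

definition gram_minor :: "(nat \<Rightarrow> nat \<Rightarrow> 'a::comm_ring_1) \<Rightarrow> nat \<Rightarrow> nat \<Rightarrow> 'a" where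
  "gram_minor D u v = gram D 2 u * gram D 2 v - gram D 2 2 * gram D u v"

definition rank_relation :: "(nat \<Rightarrow> nat \<Rightarrow> 'a::comm_ring_1) \<Rightarrow> nat \<Rightarrow> nat \<Rightarrow> nat \<Rightarrow> 'a" where
  "rank_relation D u v w = gram_minor D u w * gram_minor D v w - gram_minor D w w * gram_minor D u v"

definition pair_entry :: "(nat \<times> nat \<Rightarrow> 'a::comm_ring_1) \<Rightarrow> nat \<Rightarrow> nat \<Rightarrow> 'a" where
  "pair_entry y u v = (if u = v then 0 else y (min u v, max u v))"

text \<open>The generic symmetric matrix with zero diagonal: a determinantal expression applied to
  it becomes a polynomial that can be tested for membership in the ideal.\<close>

definition var_entry :: "nat \<Rightarrow> nat \<Rightarrow> mpoly" where
  "var_entry = pair_entry (\<lambda>i. Poly_Mapping.single (Poly_Mapping.single i 1) 1)"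

lemma (in coeff_hom) mpeval_rank_relation:
  "mpeval c (rank_relation var_entry u v w) y = rank_relation (pair_entry y) u v w"
proof -
  have "mpeval c (var_entry u v) y = pair_entry y u v" for u v
    by (simp add: var_entry_def pair_entry_def mpeval_zero mpeval_var[unfolded One_nat_def])
  then show ?thesis
    by (simp only: rank_relation_def gram_minor_def gram_def mpeval_add mpeval_diff mpeval_mult)
qed

lemma pair_in_pairs: "u \<in> {1..n} \<Longrightarrow> v \<in> {1..n} \<Longrightarrow> u \<noteq> v \<Longrightarrow> (min u v, max u v) \<in> pairs n"
  by (auto simp: pairs_def)

lemma poly_in_rank_relation:
  assumes "n \<ge> 2" "u \<in> {1..n}" "v \<in> {1..n}" "w \<in> {1..n}"
  shows "poly_in (pairs n) (rank_relation var_entry u v w)"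
proof -
  have "poly_in (pairs n) (var_entry u v)" if "u \<in> {1..n}" "v \<in> {1..n}" for u v
    using that pair_in_pairs[of u n v]
    by (simp add: var_entry_def pair_entry_def poly_in_zero poly_in_var[unfolded One_nat_def])
  with assms show ?thesis
    unfolding rank_relation_def gram_minor_def gram_def
    by (intro poly_in_diff poly_in_mult poly_in_add) auto
qed

text \<open>By the Binet-Cauchy identity each minor is -4 times a product of two planar determinants
  \<open>d u\<close> and \<open>d v\<close>, so the minors form a matrix of rank at most one. The
  labels 1 and 2 must be covered by the distance formula because every minor involves them.\<close>

lemma rank_relation_planar:
  fixes x z :: "nat \<Rightarrow> 'a::comm_ring_1"
  assumes D: "\<And>u v. u \<in> insert 1 (insert 2 A) \<Longrightarrow> v \<in> insert 1 (insert 2 A) \<Longrightarrow>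
      D u v = (x u - x v)^2 + (z u - z v)^2"
    and "u \<in> A" "v \<in> A" "w \<in> A"
  shows "rank_relation D u v w = 0"
proof -
  define d where "d u = (x 2 - x 1) * (z u - z 1) - (x u - x 1) * (z 2 - z 1)" for u
  have "gram_minor D u v = - 4 * d u * d v" if "u \<in> A" "v \<in> A" for u v
    using that by (simp add: gram_minor_def gram_def D d_def power2_eq_square algebra_simps)
  then show ?thesis
    using assms(2-) by (simp add: rank_relation_def)
qed

text \<open>The relations say that the matrix of minors has rank one, so it is the product of a vector
  \<open>e\<close> with itself, obtained from a column by dividing by the square root of its diagonal entry;
  \<open>gram D 2 u \<plusminus> e u\<close> are then, up to scaling, the two isotropic coordinates of the point \<open>u\<close>.\<close>

lemma factorization_of_rank_relation:
  fixes D :: "nat \<Rightarrow> nat \<Rightarrow> 'a::field_char_0"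
  assumes D12: "D 1 2 \<noteq> 0" and diag: "\<And>u. D u u = 0"
    and rel: "\<And>u v w. u \<in> A \<Longrightarrow> v \<in> A \<Longrightarrow> w \<in> A \<Longrightarrow> rank_relation D u v w = 0"
    and root: "\<And>w. w \<in> A \<Longrightarrow> \<exists>r. r ^ 2 = gram_minor D w w"
  obtains a b where "\<And>u v. u \<in> A \<Longrightarrow> v \<in> A \<Longrightarrow> D u v = (a u - a v) * (b u - b v)"
proof -
  have "\<exists>e. \<forall>u\<in>A. \<forall>v\<in>A. e u * e v = gram_minor D u v"
  proof (cases "\<exists>w\<in>A. gram_minor D w w \<noteq> 0")
    case True
    then obtain w r where w: "w \<in> A" "gram_minor D w w \<noteq> 0" "r ^ 2 = gram_minor D w w"
      using root by blast
    then have r: "r \<noteq> 0" "r * r = gram_minor D w w" by (auto simp: power2_eq_square)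
    have "(gram_minor D u w / r) * (gram_minor D v w / r) = gram_minor D u v"
      if "u \<in> A" "v \<in> A" for u v
    proof -
      have "gram_minor D u w * gram_minor D v w = gram_minor D w w * gram_minor D u v"
        using rel[OF that w(1)] by (simp add: rank_relation_def)
      then show ?thesis
        using r w(2) by (simp only: times_divide_times_eq) simp
    qed
    then show ?thesis by (intro exI[of _ "\<lambda>u. gram_minor D u w / r"]) simp
  next
    case False
    \<comment> \<open>The relation with labels u, u, v reads: the square of this minor equals the
      product of two diagonal minors, which vanish here.\<close>
    have "gram_minor D u v = 0" if "u \<in> A" "v \<in> A" for u v
      using rel[OF that(1,1,2)] False that by (simp add: rank_relation_def)
    then show ?thesis by (intro exI[of _ "\<lambda>_. 0"]) simp
  qed
  then obtain e where e: "\<And>u v. u \<in> A \<Longrightarrow> v \<in> A \<Longrightarrow> e u * e v = gram_minor D u v"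
    by blast
  define g where "g u = gram D 2 u" for u
  have g22: "gram D 2 2 \<noteq> 0" using D12 by (simp add: gram_def diag)
  define a where "a u = (g u + e u) / gram D 2 2" for u
  define b where "b u = (g u - e u) / 2" for u
  have "D u v = (a u - a v) * (b u - b v)" if "u \<in> A" "v \<in> A" for u v
  proof -
    \<comment> \<open>Expanded, the product on the right is a polarization of
      \<open>g u * g v - e u * e v\<close>, which equals \<open>gram D 2 2 * gram D u v\<close> by
      the choice of \<open>e\<close>. The factor 2 on the left is the denominator of
      \<open>b\<close>.\<close>
    have "2 * gram D 2 2 * ((a u - a v) * (b u - b v)) =
        (g u - g v + (e u - e v)) * (g u - g v - (e u - e v))"
    proof -
      have a_diff: "a u - a v = (g u - g v + (e u - e v)) / gram D 2 2"
        by (simp add: a_def flip: diff_divide_distrib)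
      have b_diff: "b u - b v = (g u - g v - (e u - e v)) / 2"
        by (simp add: b_def flip: diff_divide_distrib)
      show ?thesis using g22 by (simp only: a_diff b_diff) simp
    qed
    also have "\<dots> = (g u * g u - e u * e u) + (g v * g v - e v * e v) - 2 * (g u * g v - e u * e v)"
      by (simp add: algebra_simps)
    also have "\<dots> = gram D 2 2 * (gram D u u + gram D v v - 2 * gram D u v)"
      using that by (simp add: e gram_minor_def g_def algebra_simps)
    also have "gram D u u + gram D v v - 2 * gram D u v = 2 * D u v"
      by (simp add: gram_def diag)
    finally show ?thesis using g22 by simp
  qed
  then show ?thesis using that by blast
qed

text \<open>Doubling all exponents makes the order even, so the monomial factor is a square. The
  remaining factor is a power series with nonzero complex constant term and has a square root as a
  power series.\<close>

lemma fls_compose_power_2_is_square: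
  fixes f :: "complex fls"
  shows "\<exists>r. r ^ 2 = fls_compose_power f 2"
proof (cases "f = 0")
  case True
  then show ?thesis by (intro exI[of _ 0]) simp
next
  case False
  define F where "F = fls_base_factor_to_fps f"
  define G where "G = fps_compose F (fps_X ^ 2)"
  have F0: "F $ 0 \<noteq> 0"
    using False fls_base_factor_to_fps_base unfolding F_def by blast
  have "fps_radical (\<lambda>_. csqrt) (Suc 1) G ^ Suc 1 = G"
    using F0 by (subst power_radical[symmetric]) (simp_all add: G_def flip: power2_eq_square)
  then obtain H where H: "H ^ 2 = G" by (metis Suc_1)
  have "f = fps_to_fls F * fls_X_intpow (fls_subdegree f)"
    using fls_base_factor_X_power_decompose(1)[of f] False
    by (simp add: F_def fls_base_factor_to_fps_to_fls)
  then have "fls_compose_power f 2 = fps_to_fls G * fls_X_intpow (2 * fls_subdegree f)"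
    by (metis G_def fls_compose_power_X_intpow fls_compose_power_fps_to_fls fls_compose_power_mult
        of_nat_numeral zero_less_numeral)
  also have "\<dots> = (fps_to_fls H * fls_X_intpow (fls_subdegree f)) ^ 2"
    by (simp add: power_mult_distrib fls_X_intpow_power fps_to_fls_power flip: H)
  finally show ?thesis by metis
qed

lemma fls_compose_power_nonzero:
  assumes "d > 0" "f \<noteq> 0"
  shows "fls_compose_power f d \<noteq> 0"
proof -
  have "fls_compose_power f d $$ (int d * fls_subdegree f) \<noteq> 0"
    using assms by (simp add: fls_nth_compose_power)
  then show ?thesis by auto
qed

lemma fls_subdegree_compose_power:
  assumes "d > 0" "f \<noteq> 0"
  shows "fls_subdegree (fls_compose_power f d) = int d * fls_subdegree f"
proof (rule fls_subdegree_eqI)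
  show "fls_compose_power f d $$ (int d * fls_subdegree f) \<noteq> 0"
    using assms by (simp add: fls_nth_compose_power)
  fix k assume "k < int d * fls_subdegree f"
  then show "fls_compose_power f d $$ k = 0"
    using assms by (auto simp: fls_nth_compose_power)
qed

section \<open>Closedness of the set of sums of two ultrametrics\<close>

text \<open>The values are placed in increasing order and every gap between neighbours is cut down
  to at most \<open>L\<close>. A difference that changes contains a gap that was cut, and so keeps
  length at least \<open>L\<close>.\<close>

lemma gap_compression:
  fixes A :: "real set"
  assumes "finite A" "L \<ge> 0"
  shows "\<exists>\<phi>. (\<forall>s\<in>A. \<forall>t\<in>A. s \<le> t \<longrightarrow>
      0 \<le> \<phi> t - \<phi> s \<and> \<phi> t - \<phi> s \<le> t - s \<and> (\<phi> t - \<phi> s = t - s \<or> L \<le> \<phi> t - \<phi> s)) \<and>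
    (\<forall>t\<in>A. 0 \<le> \<phi> t \<and> \<phi> t \<le> L * real (card A))"
  using assms(1)
proof (induction A rule: finite_linorder_max_induct)
  case empty
  then show ?case by simp
next
  case (insert b A)
  show ?case
  proof (cases "A = {}")
    case True
    then show ?thesis using assms(2) by (intro exI[of _ "\<lambda>_. 0"]) auto
  next
    case False
    define e where "e = Max A"
    have e: "e \<in> A" "\<And>a. a \<in> A \<Longrightarrow> a \<le> e"
      using insert(1) False by (auto simp: e_def)
    have be: "e < b" using insert(2) e by blast
    from insert(3) obtain \<phi> where
      \<phi>: "\<And>s t. s \<in> A \<Longrightarrow> t \<in> A \<Longrightarrow> s \<le> t \<Longrightarrow>
        0 \<le> \<phi> t - \<phi> s \<and> \<phi> t - \<phi> s \<le> t - s \<and> (\<phi> t - \<phi> s = t - s \<or> L \<le> \<phi> t - \<phi> s)"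
      and range: "\<And>t. t \<in> A \<Longrightarrow> 0 \<le> \<phi> t \<and> \<phi> t \<le> L * real (card A)" by blast
    define \<psi> where "\<psi> = \<phi>(b := \<phi> e + min (b - e) L)"
    have b: "b \<notin> A" using insert(2) by blast
    have old: "\<psi> t = \<phi> t" if "t \<in> A" for t using that b by (auto simp: \<psi>_def)
    have new: "\<psi> b = \<phi> e + min (b - e) L" by (simp add: \<psi>_def)
    \<comment> \<open>The new difference is the sum of the last gap and an old difference. If
      neither was shortened the sum is preserved; otherwise one of them is at least \<open>L\<close>
      and the other is nonnegative.\<close>
    have top: "0 \<le> \<psi> b - \<psi> s \<and> \<psi> b - \<psi> s \<le> b - s \<and> (\<psi> b - \<psi> s = b - s \<or> L \<le> \<psi> b - \<psi> s)"
      if "s \<in> A" for s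
      using \<phi>[OF that e(1) e(2)[OF that]] be assms(2)
      unfolding old[OF that] new min_def by (auto split: if_splits)
    have "0 \<le> \<psi> t - \<psi> s \<and> \<psi> t - \<psi> s \<le> t - s \<and> (\<psi> t - \<psi> s = t - s \<or> L \<le> \<psi> t - \<psi> s)"
      if "s \<in> insert b A" "t \<in> insert b A" "s \<le> t" for s t
    proof (cases "t = b")
      case True
      then show ?thesis using that top[of s] by auto
    next
      case False
      then have "t \<in> A" "s \<in> A" using that insert(2) by force+
      then show ?thesis using \<phi> that(3) old by simp
    qed
    moreover have "0 \<le> \<psi> t \<and> \<psi> t \<le> L * real (card (insert b A))" if "t \<in> insert b A" for t
    proof -
      have "real (card (insert b A)) = real (card A) + 1"
        using b insert(1) by simp
      then show ?thesis
        using that old[of t] range[of t] range[OF e(1)] new be assms(2)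
        by (cases "t = b") (auto simp: distrib_left)
    qed
    ultimately show ?thesis by blast
  qed
qed

section \<open>Ultrametrics under order-preserving changes and limits\<close>

lemma finite_pairs: "finite (pairs n)"
  by (rule finite_subset[of _ "{1..n} \<times> {1..n}"]) (auto simp: pairs_def)

text \<open>The ultrametric inequality says that one value is at most one of two others, so it
  depends only on the order of the values.\<close>

lemma ultrametric_order_preserving:
  assumes "\<delta> \<in> ultrametrics n" "\<And>i. i \<notin> pairs n \<Longrightarrow> \<delta>' i = 0"
    and mono: "\<And>i j. i \<in> pairs n \<Longrightarrow> j \<in> pairs n \<Longrightarrow> \<delta> i \<le> \<delta> j \<Longrightarrow> \<delta>' i \<le> \<delta>' j"
  shows "\<delta>' \<in> ultrametrics n"
  unfolding ultrametrics_def
proof safe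
  fix u v w assume *: "u \<in> {1..n}" "v \<in> {1..n}" "w \<in> {1..n}" "u \<noteq> v" "u \<noteq> w" "v \<noteq> w"
  then have p: "(min u v, max u v) \<in> pairs n" "(min u w, max u w) \<in> pairs n" "(min v w, max v w) \<in> pairs n"
    by (auto simp: pairs_def)
  have "dist_pair \<delta> u v \<le> max (dist_pair \<delta> u w) (dist_pair \<delta> v w)"
    using assms(1) * unfolding ultrametrics_def by blast
  then show "dist_pair \<delta>' u v \<le> max (dist_pair \<delta>' u w) (dist_pair \<delta>' v w)"
    using mono[OF p(1,2)] mono[OF p(1,3)] unfolding dist_pair_def by (auto simp: le_max_iff_disj)
qed (use assms(2) in auto)

lemma ultrametrics_limit:
  assumes "\<And>k. \<delta> k \<in> ultrametrics n" and lim: "\<And>i. (\<lambda>k. \<delta> k i) \<longlonglongrightarrow> l i"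
  shows "l \<in> ultrametrics n"
  unfolding ultrametrics_def
proof safe
  fix a b assume "(a, b) \<notin> pairs n"
  then have "(\<lambda>k. \<delta> k (a, b)) = (\<lambda>k. 0)"
    using assms(1) unfolding ultrametrics_def by blast
  then show "l (a, b) = 0"
    using lim[of "(a, b)"] by (simp add: LIMSEQ_const_iff)
next
  fix u v w assume *: "u \<in> {1..n}" "v \<in> {1..n}" "w \<in> {1..n}" "u \<noteq> v" "u \<noteq> w" "v \<noteq> w"
  have "dist_pair (\<delta> k) u v \<le> max (dist_pair (\<delta> k) u w) (dist_pair (\<delta> k) v w)" for k
    using assms(1) * unfolding ultrametrics_def by blast
  moreover have lim': "(\<lambda>k. dist_pair (\<delta> k) u v) \<longlonglongrightarrow> dist_pair l u v" for u v
    unfolding dist_pair_def by (rule lim)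
  ultimately show "dist_pair l u v \<le> max (dist_pair l u w) (dist_pair l v w)"
    using LIMSEQ_le[OF lim' tendsto_max[OF lim' lim']] by blast
qed

text \<open>A gap of length more than 2M between values of the first summand is a gap in the
  opposite direction for the second summand, so both can be shortened without changing the order of
  the values of either summand.\<close>

lemma bounded_ultrametric_decomposition:
  assumes "\<alpha> \<in> ultrametrics n" "\<beta> \<in> ultrametrics n"
    and x: "\<And>i. i \<in> pairs n \<Longrightarrow> \<bar>\<alpha> i + \<beta> i\<bar> \<le> M"
  obtains \<alpha>' \<beta>' where "\<alpha>' \<in> ultrametrics n" "\<beta>' \<in> ultrametrics n"
    "\<And>i. \<alpha>' i + \<beta>' i = \<alpha> i + \<beta> i" "\<And>i. \<bar>\<alpha>' i\<bar> \<le> 2 * \<bar>M\<bar> * real (card (pairs n))"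
proof -
  \<comment> \<open>This bounds the difference of any two values of the sum.\<close>
  define L where "L = 2 * \<bar>M\<bar>"
  obtain \<phi> where
    \<phi>: "\<And>s t. s \<in> \<alpha> ` pairs n \<Longrightarrow> t \<in> \<alpha> ` pairs n \<Longrightarrow> s \<le> t \<Longrightarrow>
      0 \<le> \<phi> t - \<phi> s \<and> \<phi> t - \<phi> s \<le> t - s \<and> (\<phi> t - \<phi> s = t - s \<or> L \<le> \<phi> t - \<phi> s)"
    and range: "\<And>t. t \<in> \<alpha> ` pairs n \<Longrightarrow> 0 \<le> \<phi> t \<and> \<phi> t \<le> L * real (card (\<alpha> ` pairs n))"
  proof -
    have "finite (\<alpha> ` pairs n)" "0 \<le> L" by (simp_all add: L_def finite_pairs)
    from gap_compression[OF this] show ?thesis using that by blast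
  qed
  define \<alpha>' where "\<alpha>' i = (if i \<in> pairs n then \<phi> (\<alpha> i) else 0)" for i
  define \<beta>' where "\<beta>' i = \<alpha> i + \<beta> i - \<alpha>' i" for i
  have off: "\<alpha> i = 0" "\<beta> i = 0" if "i \<notin> pairs n" for i
    using assms(1,2) that unfolding ultrametrics_def by blast+
  show ?thesis
  proof
    show "\<alpha>' \<in> ultrametrics n"
      using assms(1)
    proof (rule ultrametric_order_preserving)
      fix i j assume "i \<in> pairs n" "j \<in> pairs n" "\<alpha> i \<le> \<alpha> j"
      then show "\<alpha>' i \<le> \<alpha>' j" using \<phi>[of "\<alpha> i" "\<alpha> j"] by (simp add: \<alpha>'_def)
    qed (simp add: \<alpha>'_def)
    show "\<beta>' \<in> ultrametrics n"
      using assms(2)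
    proof (rule ultrametric_order_preserving)
      fix i j assume *: "i \<in> pairs n" "j \<in> pairs n" "\<beta> i \<le> \<beta> j"
      \<comment> \<open>If \<alpha> i \<le> \<alpha> j, shortening the gap of \<alpha> only
        increases \<beta>' j - \<beta>' i. Otherwise the gap is either unchanged, and so is the
        difference of \<beta>, or still at least \<open>L\<close>, which outweighs the change of the
        sum.\<close>
      have "\<bar>\<alpha> i + \<beta> i - (\<alpha> j + \<beta> j)\<bar> \<le> L" using x[OF *(1)] x[OF *(2)] by (simp add: L_def)
      then show "\<beta>' i \<le> \<beta>' j"
        using \<phi>[of "\<alpha> i" "\<alpha> j"] \<phi>[of "\<alpha> j" "\<alpha> i"] * linear[of "\<alpha> i" "\<alpha> j"]
        by (auto simp: \<alpha>'_def \<beta>'_def)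
    qed (simp add: \<beta>'_def \<alpha>'_def off)
    have "L * real (card (\<alpha> ` pairs n)) \<le> L * real (card (pairs n))"
      by (intro mult_left_mono) (auto simp: card_image_le finite_pairs L_def)
    moreover have "0 \<le> L * real (card (pairs n))" by (simp add: L_def)
    ultimately show "\<bar>\<alpha>' i\<bar> \<le> 2 * \<bar>M\<bar> * real (card (pairs n))" for i
      using range[of "\<alpha> i"] unfolding \<alpha>'_def L_def by fastforce
  qed (simp add: \<beta>'_def)
qed

lemma tendsto_fun_iff:
  fixes f :: "'a \<Rightarrow> 'b \<Rightarrow> 'c::topological_space"
  shows "(f \<longlongrightarrow> l) F \<longleftrightarrow> (\<forall>i. ((\<lambda>x. f x i) \<longlongrightarrow> l i) F)"
proof -
  have "(f \<longlongrightarrow> l) F \<longleftrightarrow> limitin (product_topology (\<lambda>i. euclidean) UNIV) f l F"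
    by (simp add: euclidean_product_topology)
  then show ?thesis
    by (simp add: limitin_componentwise)
qed

text \<open>A sum of two unbounded closed sets need not be closed. Here the first summands can be
  chosen bounded, so a subsequence of them converges, and the second summands converge as
  differences.\<close>

lemma closed_ultrametrics_sum:
  "closed {(\<lambda>i. \<delta> i + \<delta>' i) | \<delta> \<delta>'. \<delta> \<in> ultrametrics n \<and> \<delta>' \<in> ultrametrics n}" (is "closed ?W")
  unfolding closed_sequential_limits
proof safe
  fix x :: "nat \<Rightarrow> nat \<times> nat \<Rightarrow> real" and l
  assume mem: "\<forall>k. x k \<in> ?W" and "x \<longlonglongrightarrow> l"
  then have lim: "(\<lambda>k. x k i) \<longlonglongrightarrow> l i" for i
    unfolding tendsto_fun_iff by blast
  have "\<exists>M. \<forall>k. \<bar>x k i\<bar> \<le> M" for i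
    using convergent_imp_Bseq[OF convergentI[OF lim[of i]]] by (auto simp: Bseq_def)
  then obtain m where m: "\<And>i k. \<bar>x k i\<bar> \<le> m i" by metis
  define M where "M = (\<Sum>i\<in>pairs n. m i)"
  have m0: "m i \<ge> 0" for i using m[of undefined i] by linarith
  have M: "\<bar>x k i\<bar> \<le> M" if "i \<in> pairs n" for i k
    using m[of k i] member_le_sum[OF that, of m] m0 finite_pairs unfolding M_def by force
  have "\<exists>\<alpha> \<beta>. \<alpha> \<in> ultrametrics n \<and> \<beta> \<in> ultrametrics n \<and> (\<forall>i. \<alpha> i + \<beta> i = x k i) \<and>
      (\<forall>i. \<bar>\<alpha> i\<bar> \<le> 2 * \<bar>M\<bar> * real (card (pairs n)))" for k
  proof -
    obtain \<alpha> \<beta> where *: "\<alpha> \<in> ultrametrics n" "\<beta> \<in> ultrametrics n" "x k = (\<lambda>i. \<alpha> i + \<beta> i)"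
      using mem by blast
    then have "\<bar>\<alpha> i + \<beta> i\<bar> \<le> M" if "i \<in> pairs n" for i using M[OF that, of k] by simp
    then obtain \<alpha>' \<beta>' where "\<alpha>' \<in> ultrametrics n" "\<beta>' \<in> ultrametrics n"
      "\<And>i. \<alpha>' i + \<beta>' i = \<alpha> i + \<beta> i" "\<And>i. \<bar>\<alpha>' i\<bar> \<le> 2 * \<bar>M\<bar> * real (card (pairs n))"
      using bounded_ultrametric_decomposition[OF *(1,2)] by blast
    then show ?thesis using *(3) by (intro exI[of _ \<alpha>'] exI[of _ \<beta>']) simp
  qed
  then obtain \<alpha> \<beta> where
    U: "\<And>k. \<alpha> k \<in> ultrametrics n" "\<And>k. \<beta> k \<in> ultrametrics n"
    and sum: "\<And>k i. \<alpha> k i + \<beta> k i = x k i"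
    and bd: "\<And>k i. \<bar>\<alpha> k i\<bar> \<le> 2 * \<bar>M\<bar> * real (card (pairs n))"
    by metis
  have bounded: "bounded ((\<lambda>a. a i) ` range \<alpha>)" for i
    unfolding bounded_iff using bd[of _ i] by (intro exI[of _ "2 * \<bar>M\<bar> * real (card (pairs n))"]) auto
  obtain a r where r: "strict_mono r"
    and a: "\<And>\<epsilon>. \<epsilon> > 0 \<Longrightarrow> \<forall>\<^sub>F k in sequentially. \<forall>i\<in>pairs n. dist (\<alpha> (r k) i) (a i) < \<epsilon>"
  proof -
    have "\<exists>a r. strict_mono r \<and>
        (\<forall>\<epsilon>>0. \<forall>\<^sub>F k in sequentially. \<forall>i\<in>pairs n. dist (\<alpha> (r k) i) (a i) < \<epsilon>)"
      by (rule compact_lemma_general[of "pairs n" "\<lambda>a i. a i" \<alpha> "\<lambda>a. a", rule_format])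
        (use finite_pairs bounded in auto)
    then show ?thesis using that by blast
  qed
  \<comment> \<open>The compactness argument controls only the coordinates in
    \<open>pairs n\<close>; the limit is set to 0 elsewhere, as membership in
    \<open>ultrametrics n\<close> demands.\<close>
  define a' where "a' i = (if i \<in> pairs n then a i else 0)" for i
  have alim: "(\<lambda>k. \<alpha> (r k) i) \<longlonglongrightarrow> a' i" for i
  proof (cases "i \<in> pairs n")
    case True
    show ?thesis
      unfolding tendsto_iff
    proof (intro allI impI)
      fix e :: real assume "e > 0"
      from a[OF this] show "\<forall>\<^sub>F k in sequentially. dist (\<alpha> (r k) i) (a' i) < e"
        by eventually_elim (use True in \<open>auto simp: a'_def\<close>)
    qed
  next
    case False
    then have "\<alpha> k i = 0" for k using U(1) unfolding ultrametrics_def by blast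
    then show ?thesis using False by (simp add: a'_def)
  qed
  have "(\<lambda>k. x (r k) i) \<longlonglongrightarrow> l i" for i
    using LIMSEQ_subseq_LIMSEQ[OF lim r] by (simp add: o_def)
  then have "(\<lambda>k. \<beta> (r k) i) \<longlonglongrightarrow> l i - a' i" for i
    using tendsto_diff[OF _ alim, of "\<lambda>k. x (r k) i" "l i" i] by (simp flip: sum)
  then have "(\<lambda>i. l i - a' i) \<in> ultrametrics n"
    by (rule ultrametrics_limit[of "\<lambda>k. \<beta> (r k)", OF U(2)])
  moreover have "a' \<in> ultrametrics n"
    by (rule ultrametrics_limit[of "\<lambda>k. \<alpha> (r k)", OF U(1) alim])
  ultimately show "\<exists>\<delta> \<delta>'. l = (\<lambda>i. \<delta> i + \<delta>' i) \<and> \<delta> \<in> ultrametrics n \<and> \<delta>' \<in> ultrametrics n"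
    by (intro exI[of _ a'] exI[of _ "\<lambda>i. l i - a' i"]) auto
qed

section \<open>From Laurent series to ultrametrics\<close>

text \<open>The order of a sum is at least the minimum of the orders, and negation turns this into
  the max inequality. Distinct entries keep the argument away from the zero series, whose
  \<open>fls_subdegree\<close> is 0 by convention.\<close>

lemma fls_ultrametric:
  fixes a :: "nat \<Rightarrow> 'a::ab_group_add fls"
  assumes inj: "\<And>u v. u \<in> {1..n} \<Longrightarrow> v \<in> {1..n} \<Longrightarrow> u \<noteq> v \<Longrightarrow> a u \<noteq> a v"
  shows "(\<lambda>(u, v). if (u, v) \<in> pairs n then - real_of_int (fls_subdegree (a u - a v)) / real N else 0)
    \<in> ultrametrics n" (is "?\<delta> \<in> _")
proof -
  have eq: "dist_pair ?\<delta> u v = - real_of_int (fls_subdegree (a u - a v)) / real N"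
    if "u \<in> {1..n}" "v \<in> {1..n}" "u \<noteq> v" for u v
    using that fls_subdegree_minus_sym[of "a u" "a v"]
    by (auto simp: dist_pair_def pairs_def min_def max_def)
  have "dist_pair ?\<delta> u v \<le> max (dist_pair ?\<delta> u w) (dist_pair ?\<delta> v w)"
    if "u \<in> {1..n}" "v \<in> {1..n}" "w \<in> {1..n}" "u \<noteq> v" "u \<noteq> w" "v \<noteq> w" for u v w
  proof -
    have "(a u - a w) + (a w - a v) = a u - a v" by simp
    then have "min (fls_subdegree (a u - a w)) (fls_subdegree (a v - a w)) \<le> fls_subdegree (a u - a v)"
      using fls_plus_subdegree[of "a u - a w" "a w - a v"] inj[of u v] that
        fls_subdegree_minus_sym[of "a v" "a w"] by simp
    then show ?thesis
      unfolding eq[OF that(1,2,4)] eq[OF that(1,3,5)] eq[OF that(2,3,6)]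
      by (auto simp: min_le_iff_disj le_max_iff_disj divide_right_mono)
  qed
  then show ?thesis by (auto simp: ultrametrics_def)
qed

text \<open>A polynomial vanishing on a set also vanishes on its Zariski closure, so the relations
  are checked only on real planar configurations.\<close>

lemma rank_relation_in_CM_ideal:
  assumes "n \<ge> 2" "u \<in> {1..n}" "v \<in> {1..n}" "w \<in> {1..n}"
  shows "rank_relation var_entry u v w \<in> vanishing_ideal (pairs n) (CM n 2)"
proof -
  let ?X = "{x. \<exists>p :: nat \<Rightarrow> nat \<Rightarrow> real. x = (\<lambda>(u, v). if (u, v) \<in> pairs n
      then complex_of_real (\<Sum>i<2. (p u i - p v i)^2) else 0)}"
  have "mpeval id (rank_relation var_entry u v w) x = 0" if xX: "x \<in> ?X" for x
  proof -
    obtain p :: "nat \<Rightarrow> nat \<Rightarrow> real" where x: "x = (\<lambda>(u, v). if (u, v) \<in> pairs n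
        then complex_of_real (\<Sum>i<2. (p u i - p v i)^2) else 0)"
      using xX by blast
    define Q where "Q s t = (complex_of_real (p s 0) - complex_of_real (p t 0))^2 +
        (complex_of_real (p s 1) - complex_of_real (p t 1))^2" for s t
    have Q: "x (s, t) = Q s t" if "(s, t) \<in> pairs n" for s t
      using that by (simp add: x Q_def numeral_2_eq_2)
    have Q_sym: "Q s t = Q t s" for s t
      unfolding Q_def by (simp only: power2_commute[of "complex_of_real (p s _)"])
    have "pair_entry x s t = Q s t"
      if "s \<in> insert 1 (insert 2 {1..n})" "t \<in> insert 1 (insert 2 {1..n})" for s t
    proof (cases "s = t")
      case True
      then show ?thesis by (simp add: pair_entry_def Q_def)
    next
      case False
      then have "(min s t, max s t) \<in> pairs n"
        using that assms(1) by (intro pair_in_pairs) auto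
      then show ?thesis
        using False Q[of "min s t" "max s t"] Q_sym[of s t]
        by (auto simp: pair_entry_def min_def max_def split: if_splits)
    qed
    then show ?thesis
      unfolding id_hom.mpeval_rank_relation Q_def
      by (rule rank_relation_planar[where A = "{1..n}"]) (use assms in auto)
  qed
  then have "rank_relation var_entry u v w \<in> vanishing_ideal (pairs n) ?X"
    using poly_in_rank_relation[OF assms] by (simp only: vanishing_ideal_def) blast
  then show ?thesis
    unfolding CM_def zariski_closure_def zero_set_def
    by (simp add: vanishing_ideal_def)
qed

lemma trop_point_decomposition:
  fixes y :: "nat \<times> nat \<Rightarrow> complex fls"
  assumes "n \<ge> 2" and N: "N > 0" and ne: "\<And>i. i \<in> pairs n \<Longrightarrow> y i \<noteq> 0"
    and van: "\<And>p. p \<in> vanishing_ideal (pairs n) (CM n 2) \<Longrightarrow> mpeval fls_const p y = 0"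
  obtains \<delta> \<delta>' where "\<delta> \<in> ultrametrics n" "\<delta>' \<in> ultrametrics n"
    "(\<lambda>i. if i \<in> pairs n then - real_of_int (fls_subdegree (y i)) / real N else 0) = (\<lambda>i. \<delta> i + \<delta>' i)"
proof -
  \<comment> \<open>Substituting the square of the parameter is a ring homomorphism, so it keeps the
    relations; it supplies the square roots for the factorization and doubles all orders.\<close>
  define D where "D u v = fls_compose_power (pair_entry y u v) 2" for u v
  have gram_D: "gram_minor D u v = fls_compose_power (gram_minor (pair_entry y) u v) 2" for u v
    by (simp only: gram_minor_def gram_def D_def fls_compose_power_add fls_compose_power_diff
        fls_compose_power_mult)
  have "rank_relation D u v w = fls_compose_power (rank_relation (pair_entry y) u v w) 2" for u v w
    by (simp only: rank_relation_def gram_D fls_compose_power_diff fls_compose_power_mult)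
  moreover have "rank_relation (pair_entry y) u v w = 0"
    if "u \<in> {1..n}" "v \<in> {1..n}" "w \<in> {1..n}" for u v w
    using van[OF rank_relation_in_CM_ideal[OF assms(1) that]]
    by (simp add: fls_hom.mpeval_rank_relation)
  ultimately have rel: "rank_relation D u v w = 0"
    if "u \<in> {1..n}" "v \<in> {1..n}" "w \<in> {1..n}" for u v w
    using that by simp
  have Dne: "D u v \<noteq> 0" if "u \<in> {1..n}" "v \<in> {1..n}" "u \<noteq> v" for u v
    using that ne[OF pair_in_pairs[OF that]]
    by (simp add: D_def pair_entry_def fls_compose_power_nonzero)
  obtain a b where ab: "\<And>u v. u \<in> {1..n} \<Longrightarrow> v \<in> {1..n} \<Longrightarrow> D u v = (a u - a v) * (b u - b v)"
  proof (rule factorization_of_rank_relation[where A = "{1..n}" and D = D])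
    show "D 1 2 \<noteq> 0" using Dne assms(1) by simp
    show "D u u = 0" for u by (simp add: D_def pair_entry_def)
    show "\<exists>r. r\<^sup>2 = gram_minor D w w" for w
      unfolding gram_D by (rule fls_compose_power_2_is_square)
  qed (use rel in blast)+
  have inj: "a u \<noteq> a v" "b u \<noteq> b v" if "u \<in> {1..n}" "v \<in> {1..n}" "u \<noteq> v" for u v
    using Dne[OF that] ab[OF that(1,2)] by auto
  have deg: "2 * fls_subdegree (y (u, v)) = fls_subdegree (a u - a v) + fls_subdegree (b u - b v)"
    if "(u, v) \<in> pairs n" for u v
  proof -
    have uv: "u \<in> {1..n}" "v \<in> {1..n}" "u \<noteq> v" "u < v" using that by (auto simp: pairs_def)
    then have "fls_subdegree (D u v) = 2 * fls_subdegree (y (u, v))"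
      using ne[OF that] by (simp add: D_def pair_entry_def fls_subdegree_compose_power min_def max_def)
    then show ?thesis using inj[OF uv(1-3)] by (simp add: ab[OF uv(1,2)])
  qed
  \<comment> \<open>The denominator \<open>2 * N\<close> undoes the doubling of the orders.\<close>
  let ?f = "\<lambda>a (u, v). if (u, v) \<in> pairs n
      then - real_of_int (fls_subdegree (a u - a v :: complex fls)) / real (2 * N) else 0"
  show ?thesis
  proof (rule that[of "?f a" "?f b"])
    show "?f a \<in> ultrametrics n" "?f b \<in> ultrametrics n"
      by (rule fls_ultrametric, use inj in blast)+
    show "(\<lambda>i. if i \<in> pairs n then - real_of_int (fls_subdegree (y i)) / real N else 0) =
        (\<lambda>i. ?f a i + ?f b i)"
    proof
      fix i :: "nat \<times> nat"
      obtain u v where i: "i = (u, v)" by fastforce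
      have "- real_of_int (fls_subdegree (y (u, v))) / real N =
        - real_of_int (fls_subdegree (a u - a v)) / real (2 * N)
        + - real_of_int (fls_subdegree (b u - b v)) / real (2 * N)" if "(u, v) \<in> pairs n"
      proof -
        have "2 * real_of_int (fls_subdegree (y (u, v))) =
            real_of_int (fls_subdegree (a u - a v)) + real_of_int (fls_subdegree (b u - b v))"
          using deg[OF that] by linarith
        then show ?thesis using N by (simp add: field_simps)
      qed
      then show "(if i \<in> pairs n then - real_of_int (fls_subdegree (y i)) / real N else 0) =
        ?f a i + ?f b i" by (simp add: i)
    qed
  qed
qed

section \<open>From ultrametrics to Laurent series\<close>

text \<open>Points are added one at a time. The new point z is a perturbation of an existing nearest
  point p, where nearest means that \<open>d z p\<close> is largest; the perturbation is a single
  term of order \<open>d z p\<close>.\<close>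

lemma fls_realize_ultrametric:
  fixes d :: "'b \<Rightarrow> 'b \<Rightarrow> int"
  assumes "finite A" and sym: "\<And>u v. d u v = d v u"
    and "\<And>u v w. u \<in> A \<Longrightarrow> v \<in> A \<Longrightarrow> w \<in> A \<Longrightarrow> u \<noteq> v \<Longrightarrow> u \<noteq> w \<Longrightarrow> v \<noteq> w \<Longrightarrow>
      min (d u w) (d v w) \<le> d u v"
  shows "\<exists>a :: 'b \<Rightarrow> complex fls. \<forall>u\<in>A. \<forall>v\<in>A. u \<noteq> v \<longrightarrow>
    a u \<noteq> a v \<and> fls_subdegree (a u - a v) = d u v"
  using assms(1,3)
proof (induction A rule: finite_induct)
  case empty
  then show ?case by simp
next
  case (insert z A)
  have ult: "min (d u w) (d v w) \<le> d u v"
    if "u \<in> insert z A" "v \<in> insert z A" "w \<in> insert z A" "u \<noteq> v" "u \<noteq> w" "v \<noteq> w" for u v w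
    using insert.prems that by blast
  from insert obtain a :: "'b \<Rightarrow> complex fls" where
    a: "\<And>u v. u \<in> A \<Longrightarrow> v \<in> A \<Longrightarrow> u \<noteq> v \<Longrightarrow> a u \<noteq> a v \<and> fls_subdegree (a u - a v) = d u v"
    by (metis insertI2)
  show ?case
  proof (cases "A = {}")
    case True
    then show ?thesis by simp
  next
    case False
    define e where "e = Max (d z ` A)"
    have "e \<in> d z ` A" unfolding e_def using False insert(1) by simp
    then obtain p where p: "p \<in> A" "d z p = e" by blast
    have max: "d z u \<le> e" if "u \<in> A" for u
      unfolding e_def using that insert(1) by simp
    \<comment> \<open>The coefficient c avoids the finitely many values that would cancel the term
      of order e in some difference with an existing point.\<close>
    obtain c where c: "c \<notin> insert 0 ((\<lambda>u. - ((a p - a u) $$ e)) ` A)"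
      using ex_new_if_finite[OF infinite_UNIV_char_0, of "insert 0 ((\<lambda>u. - ((a p - a u) $$ e)) ` A)"]
        insert(1) by auto
    define b where "b = a p + fls_shift (- e) (fls_const c)"
    have nth: "(b - a u) $$ k = (a p - a u) $$ k + (if k = e then c else 0)" for u k
      by (simp add: b_def)
    have ne: "(b - a u) $$ e \<noteq> 0" if "u \<in> A" for u
    proof
      assume "(b - a u) $$ e = 0"
      then have "(a p - a u) $$ e + c = 0" using nth[of u e] by (simp del: fls_minus_nth)
      then have "c = - ((a p - a u) $$ e)" by (simp only: add_eq_0_iff)
      then show False using c that by blast
    qed
    have new: "b \<noteq> a u \<and> fls_subdegree (b - a u) = d z u" if u: "u \<in> A" for u
    proof
      show "b \<noteq> a u" using ne[OF u] by auto
      show "fls_subdegree (b - a u) = d z u"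
      proof (cases "u = p")
        case True
        have "fls_subdegree (b - a p) = e"
          by (rule fls_subdegree_eqI) (use ne[OF p(1)] in \<open>auto simp: b_def\<close>)
        then show ?thesis using True p by simp
      next
        case False
        then have sub: "a p \<noteq> a u" "fls_subdegree (a p - a u) = d p u" using a[OF p(1) u] by auto
        have zn: "z \<noteq> u" "z \<noteq> p" using insert(2) u p by auto
        have tri: "min (d z p) (d u p) \<le> d z u" "min (d p z) (d u z) \<le> d p u"
          using ult[of z u p] ult[of p u z] zn False u p by auto
        show ?thesis
        \<comment> \<open>If p and u agree below order e, the uncancelled coefficient at e gives the
          order, and maximality forces \<open>d z u = e\<close>. Otherwise the perturbation lies
          above the leading term of \<open>a p - a u\<close>, and the two triangle inequalities give
          \<open>d z u = d p u\<close>.\<close>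
        proof (cases "d p u \<ge> e")
          case True
          then have "d z u = e" using tri(1) max[OF u] p sym[of u p] by auto
          moreover have "fls_subdegree (b - a u) = e"
          proof (rule fls_subdegree_eqI[OF ne[OF u]])
            fix k assume "k < e"
            then show "(b - a u) $$ k = 0"
              unfolding nth using True sub by (auto intro!: fls_eq0_below_subdegree simp del: fls_minus_nth)
          qed
          ultimately show ?thesis by simp
        next
          case F: False
          then have "d z u = d p u" using tri max[OF u] p sym[of u p] sym[of p z] sym[of u z] by auto
          moreover have "fls_subdegree (b - a u) = d p u"
          proof (rule fls_subdegree_eqI)
            show "(b - a u) $$ d p u \<noteq> 0"
              unfolding nth using F sub nth_fls_subdegree_nonzero[of "a p - a u"]
              by (auto simp del: fls_minus_nth)
            fix k assume "k < d p u"
            then show "(b - a u) $$ k = 0"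
              unfolding nth using F sub by (auto intro!: fls_eq0_below_subdegree simp del: fls_minus_nth)
          qed
          ultimately show ?thesis by simp
        qed
      qed
    qed
    show ?thesis
    proof (intro exI[of _ "a(z := b)"] ballI impI)
      fix u v assume "u \<in> insert z A" "v \<in> insert z A" "u \<noteq> v"
      then show "(a(z := b)) u \<noteq> (a(z := b)) v \<and> fls_subdegree ((a(z := b)) u - (a(z := b)) v) = d u v"
        using new[of u] new[of v] a[of u v] sym[of u v] fls_subdegree_minus_sym[of b "a u"]
        by auto
    qed
  qed
qed

text \<open>The set \<open>B\<close> collects the coordinates already released from
  \<open>C\<close>. Releasing one more is the fact that a univariate polynomial with infinitely many
  roots in an integral domain is zero.\<close>

lemma vanishing_coordinatewise_polynomial:
  fixes F :: "('b \<Rightarrow> 'a::idom) \<Rightarrow> 'a"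
  assumes "finite B" "infinite C"
    and pol: "\<And>x i. \<exists>q. \<forall>t. F (x(i := t)) = poly q t"
    and zero: "\<And>x. (\<And>i. x i \<in> C) \<Longrightarrow> F x = 0"
    and "\<And>i. i \<notin> B \<Longrightarrow> x i \<in> C"
  shows "F x = 0"
  using assms(1,5)
proof (induction B arbitrary: x rule: finite_induct)
  case empty
  then show ?case using zero by blast
next
  case (insert j B)
  obtain q where q: "\<And>t. F (x(j := t)) = poly q t" using pol by blast
  have "poly q t = 0" if "t \<in> C" for t
    unfolding q[symmetric] by (rule insert.IH) (use insert.prems that in auto)
  then have "C \<subseteq> {t. poly q t = 0}" by blast
  then have "q = 0" using assms(2) poly_roots_finite finite_subset by blast
  then show ?case using q[of "x j"] by simp
qed

lemma CM_ideal_vanishes_on_fls_configurations: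
  fixes a b :: "nat \<Rightarrow> complex fls"
  assumes p: "p \<in> vanishing_ideal (pairs n) (CM n 2)"
  shows "mpeval fls_const p (\<lambda>(u, v). (a u - a v) * (b u - b v)) = 0"
proof -
  define G :: "(nat \<times> nat \<Rightarrow> complex fls) \<Rightarrow> nat \<times> nat \<Rightarrow> complex fls"
    where "G x = (\<lambda>(u, v). (x (u, 0) - x (v, 0))^2 + (x (u, 1) - x (v, 1))^2)" for x
  define C where "C = range (\<lambda>r. fls_const (complex_of_real r))"
  have pin: "poly_in (pairs n) p" using p by (simp add: vanishing_ideal_def)
  have "inj (\<lambda>r. fls_const (complex_of_real r))"
    by (auto simp: inj_def dest: arg_cong[of _ _ "\<lambda>f. f $$ 0"])
  then have "infinite C"
    unfolding C_def using finite_imageD infinite_UNIV_char_0 by blast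
  have pol: "\<exists>q. \<forall>t. mpeval fls_const p (G (x(i := t))) = poly q t" for x i
  proof (intro exI allI)
    fix t
    \<comment> \<open>The witness polynomial is \<open>p\<close> evaluated over univariate
      polynomials, with coordinate \<open>i\<close> replaced by the indeterminate and the others by
      constants.\<close>
    let ?x = "\<lambda>j. if j = i then [:0, 1:] else [:x j:]"
    let ?q = "mpeval (\<lambda>a. [:fls_const a:]) p
      (\<lambda>(u, v). (?x (u, 0) - ?x (v, 0))^2 + (?x (u, 1) - ?x (v, 1))^2)"
    have eq: "poly (?x j) t = (x(i := t)) j" for j by simp
    have "poly ?q t = mpeval (\<lambda>a. poly [:fls_const a:] t) p
      (\<lambda>j. poly (case j of (u, v) \<Rightarrow> (?x (u, 0) - ?x (v, 0))^2 + (?x (u, 1) - ?x (v, 1))^2) t)"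
      by (rule mpeval_hom) auto
    also have "\<dots> = mpeval fls_const p (G (x(i := t)))"
      unfolding G_def by (intro arg_cong2[where f = "\<lambda>c. mpeval c p"] ext)
        (auto simp only: poly_power poly_add poly_diff eq prod.case split: prod.split, simp)
    finally show "mpeval fls_const p (G (x(i := t))) = poly ?q t" ..
  qed
  have zero: "mpeval fls_const p (G x) = 0" if "\<And>i. x i \<in> C" for x
  proof -
    have "\<exists>r. x i = fls_const (complex_of_real r)" for i using that[of i] by (auto simp: C_def)
    then obtain r where r: "\<And>i. x i = fls_const (complex_of_real (r i))" by metis
    define y where "y = (\<lambda>(u, v). if (u, v) \<in> pairs n
      then complex_of_real (\<Sum>i<2. (r (u, i) - r (v, i))^2) else 0)"
    have "y \<in> CM n 2"
      unfolding CM_def zariski_closure_def zero_set_def vanishing_ideal_def y_def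
      by (auto intro!: exI[of _ "\<lambda>u i. r (u, i)"])
    then have "mpeval id p y = 0" using p by (simp add: vanishing_ideal_def)
    then have "mpeval fls_const p (\<lambda>i. fls_const (y i)) = 0"
      using mpeval_hom[of fls_const id p y] by (simp add: fls_plus_const)
    also have "mpeval fls_const p (\<lambda>i. fls_const (y i)) = mpeval fls_const p (G x)"
      by (rule mpeval_cong[OF pin])
        (auto simp: y_def G_def r numeral_2_eq_2 fls_plus_const fls_minus_const fls_const_power)
    finally show ?thesis .
  qed
  \<comment> \<open>This solves x + \<i> z = a and x - \<i> z = b for the planar coordinates x, z of
    each point. Being 0 elsewhere, it leaves the real constants \<open>C\<close> in finitely many
    coordinates only.\<close>
  define x where "x = (\<lambda>(u, i). if u \<in> {1..n} \<and> i \<in> {0, 1::nat}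
    then if i = 0 then fls_const (1/2) * (a u + b u) else fls_const (- \<i> / 2) * (a u - b u) else 0)"
  have "mpeval fls_const p (G x) = 0"
  proof (rule vanishing_coordinatewise_polynomial[where F = "\<lambda>x. mpeval fls_const p (G x)"
        and C = C and B = "{1..n} \<times> {0, 1}"])
    fix i :: "nat \<times> nat" assume "i \<notin> {1..n} \<times> {0, 1}"
    then have "x i = 0" by (auto simp: x_def split: prod.splits)
    then show "x i \<in> C" by (auto simp: C_def intro!: image_eqI[of _ _ 0])
  qed (use \<open>infinite C\<close> pol zero in auto)
  also have "mpeval fls_const p (G x) = mpeval fls_const p (\<lambda>(u, v). (a u - a v) * (b u - b v))"
  proof (rule mpeval_cong[OF pin])
    fix i assume "i \<in> pairs n"
    then obtain u v where i: "i = (u, v)" "u \<in> {1..n}" "v \<in> {1..n}" by (auto simp: pairs_def)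
    have half: "fls_const (1/2) ^ 2 * (4 :: complex fls) = 1"
      by (simp add: power2_eq_square flip: fls_const_numeral)
    have imag: "fls_const (- \<i> / 2) ^ 2 = - (fls_const (1/2) ^ 2 :: complex fls)"
      by (simp add: power2_eq_square flip: fls_const_uminus)
    have "G x i = (fls_const (1/2) * ((a u - a v) + (b u - b v)))^2 +
        (fls_const (- \<i> / 2) * ((a u - a v) - (b u - b v)))^2"
      using i by (simp add: G_def x_def algebra_simps)
    also have "\<dots> = fls_const (1/2) ^ 2 * (((a u - a v) + (b u - b v))^2 - ((a u - a v) - (b u - b v))^2)"
      unfolding power_mult_distrib imag by (simp only: right_diff_distrib mult_minus_left add_uminus_conv_diff)
    also have "((a u - a v) + (b u - b v))^2 - ((a u - a v) - (b u - b v))^2 = 4 * ((a u - a v) * (b u - b v))"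
      by (simp add: power2_eq_square algebra_simps)
    also have "fls_const (1/2) ^ 2 * (4 * ((a u - a v) * (b u - b v))) = (a u - a v) * (b u - b v)"
      using half by (simp only: mult.assoc[symmetric]) simp
    finally show "G x i = (case i of (u, v) \<Rightarrow> (a u - a v) * (b u - b v))" using i by simp
  qed
  finally show ?thesis .
qed

text \<open>Scaling by \<open>r\<close> and taking floors are monotone, so the rounded values are an
  integral ultrametric; the sign change passes from valuations to orders.\<close>

lemma rounded_ultrametric_realizable:
  assumes "\<delta> \<in> ultrametrics n" and "r \<ge> 0"
  obtains a :: "nat \<Rightarrow> complex fls" where
    "\<And>u v. (u, v) \<in> pairs n \<Longrightarrow> a u \<noteq> a v \<and> fls_subdegree (a u - a v) = - \<lfloor>r * \<delta> (u, v)\<rfloor>"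
proof -
  define d where "d u v = - \<lfloor>r * dist_pair \<delta> u v\<rfloor>" for u v
  have "\<exists>a :: nat \<Rightarrow> complex fls. \<forall>u\<in>{1..n}. \<forall>v\<in>{1..n}. u \<noteq> v \<longrightarrow>
      a u \<noteq> a v \<and> fls_subdegree (a u - a v) = d u v"
  proof (rule fls_realize_ultrametric)
    show "d u v = d v u" for u v
      by (simp add: d_def dist_pair_def min.commute max.commute)
    fix u v w assume *: "u \<in> {1..n}" "v \<in> {1..n}" "w \<in> {1..n}" "u \<noteq> v" "u \<noteq> w" "v \<noteq> w"
    have "dist_pair \<delta> u v \<le> dist_pair \<delta> u w \<or> dist_pair \<delta> u v \<le> dist_pair \<delta> v w"
      using assms(1) * unfolding ultrametrics_def by (fastforce simp: le_max_iff_disj)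
    then have "\<lfloor>r * dist_pair \<delta> u v\<rfloor> \<le> \<lfloor>r * dist_pair \<delta> u w\<rfloor> \<or> \<lfloor>r * dist_pair \<delta> u v\<rfloor> \<le> \<lfloor>r * dist_pair \<delta> v w\<rfloor>"
      using assms(2) by (meson floor_mono mult_left_mono)
    then show "min (d u w) (d v w) \<le> d u v" by (auto simp: d_def)
  qed simp
  then obtain a :: "nat \<Rightarrow> complex fls" where a: "\<And>u v. u \<in> {1..n} \<Longrightarrow> v \<in> {1..n} \<Longrightarrow> u \<noteq> v \<Longrightarrow>
      a u \<noteq> a v \<and> fls_subdegree (a u - a v) = d u v" by blast
  show ?thesis
  proof (rule that)
    fix u v assume "(u, v) \<in> pairs n"
    then show "a u \<noteq> a v \<and> fls_subdegree (a u - a v) = - \<lfloor>r * \<delta> (u, v)\<rfloor>"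
      using a[of u v] by (auto simp: pairs_def d_def dist_pair_def min_def max_def)
  qed
qed

lemma ultrametrics_sum_in_trop:
  assumes "\<delta> \<in> ultrametrics n" "\<delta>' \<in> ultrametrics n"
  shows "(\<lambda>i. \<delta> i + \<delta>' i) \<in> trop (pairs n) (CM n 2)"
  unfolding trop_def closure_sequential
proof (intro exI conjI allI)
  let ?r = "\<lambda>k::nat. real (Suc k)"
  \<comment> \<open>Each summand is rounded down to a multiple of \<open>1 / Suc k\<close>, so the
    approximation is a valuation with ramification index \<open>Suc k\<close>.\<close>
  let ?x = "\<lambda>k i. if i \<in> pairs n then
      of_int \<lfloor>?r k * \<delta> i\<rfloor> / ?r k + of_int \<lfloor>?r k * \<delta>' i\<rfloor> / ?r k else 0"
  have off: "\<delta> i = 0" "\<delta>' i = 0" if "i \<notin> pairs n" for i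
    using assms that unfolding ultrametrics_def by blast+
  have round: "(\<lambda>k. of_int \<lfloor>?r k * t\<rfloor> / ?r k) \<longlonglongrightarrow> t" for t :: real
  proof (rule tendsto_sandwich[of "\<lambda>k. t - 1 / ?r k" _ _ "\<lambda>_. t"])
    have "t * ?r k - 1 \<le> of_int \<lfloor>?r k * t\<rfloor>" "of_int \<lfloor>?r k * t\<rfloor> \<le> t * ?r k" for k
      by (simp_all only: mult.commute[of t]) linarith+
    then show "\<forall>\<^sub>F k in sequentially. t - 1 / ?r k \<le> of_int \<lfloor>?r k * t\<rfloor> / ?r k"
      "\<forall>\<^sub>F k in sequentially. of_int \<lfloor>?r k * t\<rfloor> / ?r k \<le> t"
      by (auto intro!: always_eventually simp: pos_le_divide_eq pos_divide_le_eq left_diff_distrib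
          simp del: of_nat_Suc)
    show "(\<lambda>k. t - 1 / ?r k) \<longlonglongrightarrow> t"
      using tendsto_diff[OF tendsto_const LIMSEQ_inverse_real_of_nat, of t]
      by (simp add: inverse_eq_divide)
  qed simp
  show "?x \<longlonglongrightarrow> (\<lambda>i. \<delta> i + \<delta>' i)"
    unfolding tendsto_fun_iff
  proof
    fix i
    show "(\<lambda>k. ?x k i) \<longlonglongrightarrow> \<delta> i + \<delta>' i"
      using tendsto_add[OF round[of "\<delta> i"] round[of "\<delta>' i"]] off[of i]
      by (cases "i \<in> pairs n") simp_all
  qed
  fix k
  obtain a :: "nat \<Rightarrow> complex fls" where
    a: "\<And>u v. (u, v) \<in> pairs n \<Longrightarrow> a u \<noteq> a v \<and> fls_subdegree (a u - a v) = - \<lfloor>?r k * \<delta> (u, v)\<rfloor>"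
    using rounded_ultrametric_realizable[OF assms(1), of "?r k"] by auto
  obtain b :: "nat \<Rightarrow> complex fls" where
    b: "\<And>u v. (u, v) \<in> pairs n \<Longrightarrow> b u \<noteq> b v \<and> fls_subdegree (b u - b v) = - \<lfloor>?r k * \<delta>' (u, v)\<rfloor>"
    using rounded_ultrametric_realizable[OF assms(2), of "?r k"] by auto
  let ?y = "\<lambda>(u, v). (a u - a v) * (b u - b v)"
  have "?x k = (\<lambda>i. if i \<in> pairs n then - real_of_int (fls_subdegree (?y i)) / real (Suc k) else 0)"
  proof
    fix i :: "nat \<times> nat"
    obtain u v where "i = (u, v)" by fastforce
    then show "?x k i = (if i \<in> pairs n then - real_of_int (fls_subdegree (?y i)) / real (Suc k) else 0)"
      using a[of u v] b[of u v] by (simp add: add_divide_distrib del: of_nat_Suc)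
  qed
  moreover have "?y i \<noteq> 0" if "i \<in> pairs n" for i
    using a b that by (cases i) auto
  moreover have "mpeval fls_const p ?y = 0" if "p \<in> vanishing_ideal (pairs n) (CM n 2)" for p
    using CM_ideal_vanishes_on_fls_configurations[OF that] .
  ultimately show "?x k \<in> {\<delta>. \<exists>N y. N > 0 \<and> (\<forall>i\<in>pairs n. y i \<noteq> 0) \<and>
      (\<forall>p\<in>vanishing_ideal (pairs n) (CM n 2). mpeval fls_const p y = 0) \<and>
      \<delta> = (\<lambda>i. if i \<in> pairs n then - real_of_int (fls_subdegree (y i)) / real N else 0)}"
    by (intro CollectI exI[of _ "Suc k"] exI[of _ ?y]) auto
qed

theorem theorem3p1:
  fixes n :: nat
  assumes "n \<ge> 2"
  shows "trop (pairs n) (CM n 2) =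
         {(\<lambda>i. \<delta> i + \<delta>' i) | \<delta> \<delta>'. \<delta> \<in> ultrametrics n \<and> \<delta>' \<in> ultrametrics n}"
proof
  show "trop (pairs n) (CM n 2) \<subseteq>
      {(\<lambda>i. \<delta> i + \<delta>' i) | \<delta> \<delta>'. \<delta> \<in> ultrametrics n \<and> \<delta>' \<in> ultrametrics n}"
    unfolding trop_def
  \<comment> \<open>Since the target is closed, only actual valuation vectors have to be decomposed,
    not their limits.\<close>
  proof (rule closure_minimal[OF _ closed_ultrametrics_sum], safe)
    fix N :: nat and y :: "nat \<times> nat \<Rightarrow> complex fls"
    assume "N > 0" "\<forall>i\<in>pairs n. y i \<noteq> 0"
      "\<forall>p\<in>vanishing_ideal (pairs n) (CM n 2). mpeval fls_const p y = 0"
    then obtain \<delta> \<delta>' where "\<delta> \<in> ultrametrics n" "\<delta>' \<in> ultrametrics n"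
      "(\<lambda>i. if i \<in> pairs n then - real_of_int (fls_subdegree (y i)) / real N else 0) = (\<lambda>i. \<delta> i + \<delta>' i)"
      using trop_point_decomposition[OF assms] by blast
    then show "\<exists>\<delta> \<delta>'. (\<lambda>i. if i \<in> pairs n then - real_of_int (fls_subdegree (y i)) / real N else 0) =
        (\<lambda>i. \<delta> i + \<delta>' i) \<and> \<delta> \<in> ultrametrics n \<and> \<delta>' \<in> ultrametrics n"
      by blast
  qed
  show "{(\<lambda>i. \<delta> i + \<delta>' i) | \<delta> \<delta>'. \<delta> \<in> ultrametrics n \<and> \<delta>' \<in> ultrametrics n}
      \<subseteq> trop (pairs n) (CM n 2)"
    using ultrametrics_sum_in_trop by blast
qed

end
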